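(* Let $G\colon\mathbb{R}^2\to\mathbb{R}^2$ be a unipotent map of class $C^1$. If $G$ is fixed point free, then $G$ is topologically conjugated to the global translation $\tau(x,y)=(x+1,y)$; that is, there exists a homeomorphism $\varphi\colon\mathbb{R}^2\to\mathbb{R}^2$ such that $\varphi\circ G\circ\varphi^{-1}=\tau$.
   Context: A differentiable map $G\colon\mathbb{R}^2\to\mathbb{R}^2$ is called unipotent if its spectrum $\mathrm{Spc}(G)=\{\text{eigenvalues of } DG_z : z\in\mathbb{R}^2\}\subset\mathbb{C}$ is the set $\{1\}$. The map $G$ is fixed point free if $G(q)\neq q$ for all $q\in\mathbb{R}^2$. *)

theory Defs
  imports "HOL-Analysis.Analysis"
begin

text \<open>Eigenvalues of a real matrix are taken in the complex numbers, so eigenvectors range over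
  complex vectors.\<close>

definition complex_eigenvalues :: "real ^ 'n ^ 'n \<Rightarrow> complex set" where
  "complex_eigenvalues A =
     {c. \<exists>v :: complex ^ 'n. v \<noteq> 0 \<and> map_matrix complex_of_real A *v v = c *s v}"

definition Spc :: "(real ^ 'n \<Rightarrow> real ^ 'n) \<Rightarrow> complex set" where
  "Spc G = (\<Union>z. complex_eigenvalues (jacobian G (at z)))"

definition unipotent_map :: "(real ^ 2 \<Rightarrow> real ^ 2) \<Rightarrow> bool" where
  "unipotent_map G \<longleftrightarrow> G differentiable_on UNIV \<and> Spc G = {1}"

text \<open>Continuity of the derivative is with respect to the operator norm on bounded linear maps.\<close>

definition C1_map :: "('a::real_normed_vector \<Rightarrow> 'b::real_normed_vector) \<Rightarrow> bool" where
  "C1_map G \<longleftrightarrow>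
     (\<exists>G' :: 'a \<Rightarrow> 'a \<Rightarrow>\<^sub>L 'b.
        (\<forall>z. (G has_derivative blinfun_apply (G' z)) (at z)) \<and> continuous_on UNIV G')"

definition fixed_point_free :: "('a \<Rightarrow> 'a) \<Rightarrow> bool" where
  "fixed_point_free G \<longleftrightarrow> (\<forall>q. G q \<noteq> q)"

definition topologically_conjugated ::
    "('a::topological_space \<Rightarrow> 'a) \<Rightarrow> ('b::topological_space \<Rightarrow> 'b) \<Rightarrow> bool" where
  "topologically_conjugated F G \<longleftrightarrow>
     (\<exists>\<phi> \<phi>'. homeomorphism UNIV UNIV \<phi> \<phi>' \<and> \<phi> \<circ> F \<circ> \<phi>' = G)"

definition global_translation :: "real ^ 2 \<Rightarrow> real ^ 2" where
  "global_translation p = vector [p $ 1 + 1, p $ 2]"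

end

theory Submission
  imports Defs
begin

text \<open>
  Write \<open>G = id + (P, Q)\<close>. Unipotence says that the Jacobian of the displacement \<open>(P, Q)\<close> is
  nilpotent everywhere: its trace and its determinant vanish, so it has the form
  \<open>(a, b; c, -a)\<close> with \<open>a\<^sup>2 + b c = 0\<close>. Up to a rotation by a right angle such a field is the
  gradient of a function whose Hessian is degenerate, and the core of the proof is the
  Hartman--Nirenberg phenomenon that the graph of such a function over the whole plane is a cylinder.

  Locally, where \<open>b \<noteq> 0\<close>, the level curves of \<open>P\<close> are graphs \<open>y = Y x p\<close> on which \<open>Q\<close> is constant
  as well, say \<open>Q = q p\<close>. Vanishing of the trace gives \<open>\<partial>Y/\<partial>x = - P\<^sub>x / P\<^sub>y = Q\<^sub>y / P\<^sub>y = q' p\<close>, and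
  this does not depend on \<open>x\<close>: the level curves are straight. Differentiating
  \<open>Y x p = Y x0 p + q' p * (x - x0)\<close> in \<open>p\<close> shows that \<open>\<partial>Y/\<partial>p = 1 / b\<close> is an affine function of \<open>x\<close>
  along each such line (\<open>level_curves_straight_locally\<close>). An affine function is bounded on bounded
  intervals, so \<open>b\<close> cannot tend to zero at a finite point and the line never leaves the region
  \<open>b \<noteq> 0\<close> (\<open>level_line_complete\<close>). Complete lines with different directions would meet in a
  point at which the Jacobian has two independent null vectors and is not zero; hence all the null
  lines are parallel (\<open>common_null_direction\<close>).

  In the orthonormal coordinates \<open>(s, t)\<close> along and across this direction the map \<open>G\<close> therefore is
  \<open>(s, t) \<mapsto> (s + \<psi> t, t + k)\<close> with \<open>\<psi>\<close> continuous and \<open>k\<close> constant (\<open>cylindrical_form\<close>). If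
  \<open>k = 0\<close>, absence of fixed points means that \<open>\<psi>\<close> has no zero, and dividing \<open>s\<close> by \<open>\<psi> t\<close> turns the
  map into the unit translation. If \<open>k \<noteq> 0\<close>, a continuous solution \<open>\<theta>\<close> of
  \<open>\<theta> (t + k) - \<theta> t = \<psi> t\<close> straightens the map by the shear \<open>s \<mapsto> s - \<theta> t\<close>
  (\<open>skew_translation_conjugated_to_translation\<close>).
\<close>

section \<open>Plane fields with nilpotent derivative\<close>

text \<open>The functions \<open>a\<close>, \<open>b\<close>, \<open>c\<close> are the entries of the Jacobian matrix \<open>(a, b; c, -a)\<close> of
  \<open>(P, Q)\<close>; the lower right entry encodes that the trace is zero.\<close>

locale nilpotent_plane_field =
  fixes P Q a b c :: "real \<times> real \<Rightarrow> real"
  assumes derP: "\<And>z. (P has_derivative (\<lambda>h. a z * fst h + b z * snd h)) (at z)"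
    and derQ: "\<And>z. (Q has_derivative (\<lambda>h. c z * fst h - a z * snd h)) (at z)"
    and cont: "continuous_on UNIV a" "continuous_on UNIV b" "continuous_on UNIV c"
    and det: "\<And>z. (a z)\<^sup>2 + b z * c z = 0"
begin

text \<open>In the coordinates \<open>(x, P)\<close> supplied by the inverse function theorem, \<open>Q\<close> becomes a
  function of \<open>P\<close> alone because the determinant vanishes, and because the trace vanishes the slope of
  a level curve of \<open>P\<close> is the derivative of this function. The slope is thus constant on each
  level curve. That \<open>1 / b\<close> is affine along the line is what prevents \<open>b\<close> from degenerating there.\<close>

lemma level_curves_straight_locally:
  assumes b0: "b (x0, y0) \<noteq> 0" and m: "m = - a (x0, y0) / b (x0, y0)"
  obtains r \<kappa> where "r > 0"
    and "\<And>x. \<bar>x - x0\<bar> < r \<Longrightarrow>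
           b (x, y0 + m * (x - x0)) \<noteq> 0
         \<and> - a (x, y0 + m * (x - x0)) / b (x, y0 + m * (x - x0)) = m
         \<and> 1 / b (x, y0 + m * (x - x0)) = 1 / b (x0, y0) + \<kappa> * (x - x0)"
proof -
  define f where "f z = (fst z, P z)" for z
  define f' where "f' z = Blinfun (\<lambda>h. (fst h, a z * fst h + b z * snd h))" for z
  have f'_apply: "blinfun_apply (f' z) = (\<lambda>h. (fst h, a z * fst h + b z * snd h))" for z
    unfolding f'_def by (rule bounded_linear_Blinfun_apply) (intro bounded_linear_intros)
  have derf: "(f has_derivative blinfun_apply (f' z)) (at z)" for z
    unfolding f'_apply f_def by (intro has_derivative_Pair has_derivative_fst derP has_derivative_ident)
  have contf': "continuous_on UNIV f'"
    by (rule continuous_on_blinfun_componentwise)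
       (auto simp: f'_apply intro!: continuous_intros cont)
  \<comment> \<open>The inverse of \<open>f' z\<close> where \<open>b z \<noteq> 0\<close>.\<close>
  define w where "w z h = (fst h, (snd h - a z * fst h) / b z)" for z and h :: "real \<times> real"
  have w_lin: "bounded_linear (w z)" for z
    unfolding w_def divide_inverse by (intro bounded_linear_intros)
  have w_inv: "inv (blinfun_apply (f' z)) = w z" if "b z \<noteq> 0" for z
    by (rule inv_unique_comp) (use that in \<open>auto simp: fun_eq_iff f'_apply w_def field_simps\<close>)
  have opn: "open {z. b z \<noteq> 0}"
    using open_Collect_neq[OF cont(2) continuous_on_const] by simp
  have "Blinfun (w (x0, y0)) o\<^sub>L f' (x0, y0) = id_blinfun"
    using b0 by (intro blinfun_eqI) (simp add: bounded_linear_Blinfun_apply[OF w_lin] f'_apply w_def)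
  moreover have "(x0, y0) \<in> {z. b z \<noteq> 0}" using b0 by simp
  ultimately obtain U V g g' where UV: "U \<subseteq> {z. b z \<noteq> 0}" "(x0, y0) \<in> U" "open V" "f (x0, y0) \<in> V"
    and hom: "homeomorphism U V f g"
    and g': "\<And>v. v \<in> V \<Longrightarrow> (g has_derivative g' v) (at v)"
            "\<And>v. v \<in> V \<Longrightarrow> g' v = inv (blinfun_apply (f' (g v)))"
    using inverse_function_theorem[OF opn derf continuous_on_subset[OF contf' subset_UNIV]] by metis
  have gV: "b (g v) \<noteq> 0" "fst (g v) = fst v" if "v \<in> V" for v
  proof -
    have "g v \<in> U" "f (g v) = v" using hom that by (auto simp: homeomorphism_def)
    then show "b (g v) \<noteq> 0" "fst (g v) = fst v" using UV(1) by (auto simp: f_def dest: arg_cong[of _ _ fst])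
  qed
  have derg: "(g has_derivative w (g v)) (at v)" if "v \<in> V" for v
    using g'[OF that] w_inv gV(1)[OF that] by simp
  define p0 where "p0 = P (x0, y0)"
  have g0: "g (x0, p0) = (x0, y0)"
    using hom UV(2) by (auto simp: homeomorphism_def f_def p0_def)
  obtain A B where AB: "open A" "open B" "x0 \<in> A" "p0 \<in> B" "A \<times> B \<subseteq> V"
    using UV(3,4) by (auto simp: f_def p0_def elim!: open_prod_elim)
  obtain r1 r2 where r12: "r1 > 0" "ball x0 r1 \<subseteq> A" "r2 > 0" "ball p0 r2 \<subseteq> B"
    using AB by (meson openE)
  define J where "J = ball x0 r1"
  define I where "I = ball p0 r2"
  have JI: "x \<in> J \<Longrightarrow> p \<in> I \<Longrightarrow> (x, p) \<in> V" for x p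
    using AB(5) r12(2,4) unfolding J_def I_def by blast
  have J: "open J" "convex J" "x0 \<in> J" and I: "open I" "convex I" "p0 \<in> I"
    using r12 by (auto simp: J_def I_def)
  \<comment> \<open>Level curves as graphs: \<open>P (x, Y x p) = p\<close>. Their slope at \<open>(x, Y x p)\<close> is \<open>\<mu> x p\<close>.\<close>
  define Y where "Y x p = snd (g (x, p))" for x p
  have g_eq: "g (x, p) = (x, Y x p)" if "x \<in> J" "p \<in> I" for x p
    using gV(2)[OF JI[OF that]] by (simp add: Y_def prod_eq_iff)
  define q where "q x p = Q (g (x, p))" for x p
  define \<mu> where "\<mu> x p = - a (g (x, p)) / b (g (x, p))" for x p
  have derY: "((\<lambda>v. snd (g v)) has_derivative (\<lambda>h. snd (w (g v) h))) (at v)" if "v \<in> V" for v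
    by (intro has_derivative_snd derg that)
  have derq: "((\<lambda>v. Q (g v)) has_derivative
      (\<lambda>h. c (g v) * fst (w (g v) h) - a (g v) * snd (w (g v) h))) (at v)" if "v \<in> V" for v
    by (rule has_derivative_compose[OF derg[OF that] derQ])
  have dx: "((\<lambda>x. (x, p)) has_derivative (\<lambda>h. (h, 0))) (at x)"
    and dp: "((\<lambda>p. (x, p)) has_derivative (\<lambda>h. (0, h))) (at p)" for x p :: real
    by (auto intro!: derivative_eq_intros)
  have Yx: "((\<lambda>x. Y x p) has_real_derivative \<mu> x p) (at x)"
    and Yp: "((\<lambda>p. Y x p) has_real_derivative 1 / b (g (x, p))) (at p)"
    and qx: "((\<lambda>x. q x p) has_real_derivative 0) (at x)"
    and qp: "((\<lambda>p. q x p) has_real_derivative \<mu> x p) (at p)"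
    if "x \<in> J" "p \<in> I" for x p
  proof -
    note v = JI[OF that]
    note bnz = gV(1)[OF v]
    show "((\<lambda>x. Y x p) has_real_derivative \<mu> x p) (at x)"
      unfolding Y_def
      by (rule has_derivative_imp_has_field_derivative[OF has_derivative_compose[OF dx derY[OF v]]])
         (simp add: w_def \<mu>_def)
    show "((\<lambda>p. Y x p) has_real_derivative 1 / b (g (x, p))) (at p)"
      unfolding Y_def
      by (rule has_derivative_imp_has_field_derivative[OF has_derivative_compose[OF dp derY[OF v]]])
         (simp add: w_def)
    \<comment> \<open>Constancy of \<open>Q\<close> on the level curve is exactly the vanishing of the determinant.\<close>
    have "c (g (x, p)) * h - a (g (x, p)) * (- (a (g (x, p)) * h) / b (g (x, p))) = 0" for h
    proof -
      have "b (g (x, p)) * (c (g (x, p)) * h - a (g (x, p)) * (- (a (g (x, p)) * h) / b (g (x, p))))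
          = h * ((a (g (x, p)))\<^sup>2 + b (g (x, p)) * c (g (x, p)))"
        using bnz by (simp add: field_simps power2_eq_square)
      then show ?thesis using bnz det by simp
    qed
    then show "((\<lambda>x. q x p) has_real_derivative 0) (at x)"
      unfolding q_def
      by (intro has_derivative_imp_has_field_derivative[OF has_derivative_compose[OF dx derq[OF v]]])
         (simp add: w_def)
    show "((\<lambda>p. q x p) has_real_derivative \<mu> x p) (at p)"
      unfolding q_def
      by (rule has_derivative_imp_has_field_derivative[OF has_derivative_compose[OF dp derq[OF v]]])
         (simp add: w_def \<mu>_def)
  qed
  have q_const: "q x p = q x0 p" if "x \<in> J" "p \<in> I" for x p
    using has_field_derivative_zero_constant[OF J(2), of "\<lambda>x. q x p"] J(3) that
      has_field_derivative_at_within[OF qx[OF _ that(2)]] by metis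
  \<comment> \<open>By the trace condition \<open>\<mu> x\<close> is the derivative of \<open>q x\<close>, which is the same function for all \<open>x\<close>.\<close>
  have \<mu>_const: "\<mu> x p = \<mu> x0 p" if "x \<in> J" "p \<in> I" for x p
  proof -
    have "((\<lambda>p. q x0 p) has_real_derivative \<mu> x p) (at p)"
      using has_field_derivative_transform_within_open[OF qp[OF that] I(1) that(2)] q_const that(1)
      by blast
    then show ?thesis using DERIV_unique qp[OF J(3) that(2)] by blast
  qed
  have Y_affine: "Y x p = Y x0 p + \<mu> x0 p * (x - x0)" if "x \<in> J" "p \<in> I" for x p
  proof -
    have "((\<lambda>x. Y x p - \<mu> x0 p * x) has_real_derivative 0) (at x within J)" if "x \<in> J" for x
      by (rule has_field_derivative_at_within)
         (use Yx[OF that \<open>p \<in> I\<close>] \<mu>_const[OF that \<open>p \<in> I\<close>] in \<open>auto intro!: derivative_eq_intros\<close>)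
    then obtain C where "\<And>x. x \<in> J \<Longrightarrow> Y x p - \<mu> x0 p * x = C"
      using has_field_derivative_zero_constant[OF J(2), of "\<lambda>x. Y x p - \<mu> x0 p * x"] by metis
    from this[OF that(1)] this[OF J(3)] show ?thesis by (simp add: algebra_simps)
  qed
  have \<mu>0: "\<mu> x0 p0 = m" by (simp add: \<mu>_def g0 m)
  have Y0: "Y x0 p0 = y0" by (simp add: Y_def g0)
  define x1 where "x1 = x0 + r1 / 2"
  have x1: "x1 \<in> J" "x1 \<noteq> x0" using r12 by (auto simp: x1_def J_def dist_real_def)
  define \<kappa> where "\<kappa> = (1 / b (g (x1, p0)) - 1 / b (x0, y0)) / (x1 - x0)"
  \<comment> \<open>The slope is a difference quotient of \<open>Y\<close> in \<open>x\<close>, hence differentiable in \<open>p\<close> although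
    \<open>P\<close> and \<open>Q\<close> are only once differentiable.\<close>
  have "((\<lambda>p. (Y x1 p - Y x0 p) / (x1 - x0)) has_real_derivative \<kappa>) (at p0)"
    unfolding \<kappa>_def
    by (intro DERIV_cdivide DERIV_diff Yp[OF x1(1) I(3)] Yp[OF J(3) I(3), unfolded g0])
  then have d\<mu>: "((\<lambda>p. \<mu> x0 p) has_real_derivative \<kappa>) (at p0)"
    by (rule has_field_derivative_transform_within_open[OF _ I(1,3)])
       (use x1 in \<open>simp add: Y_affine[OF x1(1)]\<close>)
  have line: "g (x, p0) = (x, y0 + m * (x - x0))" if "x \<in> J" for x
    using Y_affine[OF that I(3)] g_eq[OF that I(3)] by (simp add: Y0 \<mu>0)
  have slope_affine: "1 / b (g (x, p0)) = 1 / b (x0, y0) + \<kappa> * (x - x0)" if "x \<in> J" for x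
  proof -
    have "((\<lambda>p. Y x0 p + \<mu> x0 p * (x - x0)) has_real_derivative 1 / b (x0, y0) + \<kappa> * (x - x0)) (at p0)"
      by (intro DERIV_add DERIV_cmult_right d\<mu> Yp[OF J(3) I(3), unfolded g0])
    then have "((\<lambda>p. Y x p) has_real_derivative 1 / b (x0, y0) + \<kappa> * (x - x0)) (at p0)"
      by (rule has_field_derivative_transform_within_open[OF _ I(1,3)]) (simp add: Y_affine[OF that])
    then show ?thesis using DERIV_unique Yp[OF that I(3)] by blast
  qed
  show thesis
  proof (rule that[OF r12(1), of \<kappa>])
    fix x assume "\<bar>x - x0\<bar> < r1"
    then have x: "x \<in> J" by (simp add: J_def dist_real_def abs_minus_commute)
    have "- a (g (x, p0)) / b (g (x, p0)) = m"
      using \<mu>_const[OF x I(3)] \<mu>0 by (simp only: \<mu>_def)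
    with gV(1)[OF JI[OF x I(3)]] slope_affine[OF x]
    show "b (x, y0 + m * (x - x0)) \<noteq> 0
         \<and> - a (x, y0 + m * (x - x0)) / b (x, y0 + m * (x - x0)) = m
         \<and> 1 / b (x, y0 + m * (x - x0)) = 1 / b (x0, y0) + \<kappa> * (x - x0)"
      unfolding line[OF x] by blast
  qed
qed

text \<open>The points of the line at which \<open>b\<close> times a fixed affine function equals one, and at which the
  slope is still \<open>m\<close>, form a closed set, and its interior is closed too: near a limit of interior
  points \<open>1 / b\<close> is affine by the local result, and two affine functions that agree on an open set
  are equal. By connectedness the interior is the whole line.\<close>

lemma level_line_complete:
  assumes b0: "b (x0, y0) \<noteq> 0" and m: "m = - a (x0, y0) / b (x0, y0)"
  shows "b (x, y0 + m * (x - x0)) \<noteq> 0 \<and> - a (x, y0 + m * (x - x0)) / b (x, y0 + m * (x - x0)) = m"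
proof -
  define l where "l x = (x, y0 + m * (x - x0))" for x
  have near: "\<exists>r>0. \<exists>\<kappa>. \<forall>x\<in>ball t r.
      b (l x) \<noteq> 0 \<and> - a (l x) / b (l x) = m \<and> 1 / b (l x) = 1 / b (l t) + \<kappa> * (x - t)"
    if bt: "b (l t) \<noteq> 0" and mt: "- a (l t) / b (l t) = m" for t
  proof -
    obtain r \<kappa> where "r > 0" and r: "\<And>x. \<bar>x - t\<bar> < r \<Longrightarrow>
           b (x, y0 + m * (t - x0) + m * (x - t)) \<noteq> 0
         \<and> - a (x, y0 + m * (t - x0) + m * (x - t)) / b (x, y0 + m * (t - x0) + m * (x - t)) = m
         \<and> 1 / b (x, y0 + m * (t - x0) + m * (x - t)) = 1 / b (l t) + \<kappa> * (x - t)"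
      using level_curves_straight_locally[of t "y0 + m * (t - x0)" m] bt mt unfolding l_def by metis
    have eq: "(x, y0 + m * (t - x0) + m * (x - t)) = l x" for x by (simp add: l_def algebra_simps)
    have "\<bar>x - t\<bar> < r" if "x \<in> ball t r" for x using that by (simp add: dist_real_def)
    with r[unfolded eq] \<open>r > 0\<close> show ?thesis by blast
  qed
  have l0: "l x0 = (x0, y0)" by (simp add: l_def)
  obtain r0 \<kappa>0 where r0: "r0 > 0" "\<And>x. x \<in> ball x0 r0 \<Longrightarrow> b (l x) \<noteq> 0 \<and> - a (l x) / b (l x) = m
      \<and> 1 / b (l x) = 1 / b (l x0) + \<kappa>0 * (x - x0)"
    using near[of x0] b0 m unfolding l0 by metis
  define h where "h x = 1 / b (l x0) + \<kappa>0 * (x - x0)" for x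
  \<comment> \<open>Stated without division, so that the set is closed and \<open>b \<noteq> 0\<close> holds on it.\<close>
  define C where "C = {x. b (l x) * h x = 1 \<and> - a (l x) = m * b (l x)}"
  have cl: "continuous_on UNIV l" unfolding l_def by (intro continuous_intros)
  have "closed C"
    unfolding C_def h_def
    by (intro closed_Collect_conj closed_Collect_eq continuous_intros
          continuous_on_compose2[OF cont(1) cl] continuous_on_compose2[OF cont(2) cl]) auto
  have CI: "x \<in> C" if "b (l x) \<noteq> 0" "- a (l x) / b (l x) = m" "1 / b (l x) = h x" for x
    using that by (auto simp: C_def field_simps)
  have CD: "b (l x) \<noteq> 0" "- a (l x) / b (l x) = m" "1 / b (l x) = h x" if "x \<in> C" for x
  proof -
    show "b (l x) \<noteq> 0" using that by (auto simp: C_def)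
    with that show "- a (l x) / b (l x) = m" "1 / b (l x) = h x"
      by (auto simp: C_def field_simps)
  qed
  have "ball x0 r0 \<subseteq> C" using r0(2) CI by (auto simp: h_def)
  then have "x0 \<in> interior C" using r0(1) by (auto simp: mem_interior)
  moreover have "closed (interior C)"
  proof -
    have "t \<in> interior C" if "t \<in> closure (interior C)" for t
    proof -
      have "t \<in> C"
        using that \<open>closed C\<close> by (meson closure_minimal interior_subset subsetD)
      then obtain r \<kappa> where r: "r > 0" "\<And>x. x \<in> ball t r \<Longrightarrow> b (l x) \<noteq> 0 \<and> - a (l x) / b (l x) = m
          \<and> 1 / b (l x) = 1 / b (l t) + \<kappa> * (x - t)"
        using near[of t] CD by metis
      have "open (ball t r \<inter> interior C)" by auto
      moreover have "ball t r \<inter> interior C \<noteq> {}"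
      proof -
        obtain y where "y \<in> interior C" "dist y t < r"
          using \<open>t \<in> closure (interior C)\<close> r(1) by (auto simp: closure_approachable)
        then show ?thesis by (auto simp: dist_commute)
      qed
      ultimately obtain u e where u: "u \<in> ball t r \<inter> interior C" "e > 0" "ball u e \<subseteq> ball t r \<inter> interior C"
        by (metis all_not_in_conv openE)
      define u' where "u' = u + e / 2"
      have u': "u' \<in> ball t r \<inter> interior C" "u' \<noteq> u"
        using u by (auto simp: u'_def dist_real_def subset_iff)
      have hu: "1 / b (l t) + \<kappa> * (v - t) = h v" if "v \<in> ball t r \<inter> interior C" for v
        using r(2)[of v] CD(3)[of v] that interior_subset[of C] by auto
      have "(\<kappa> - \<kappa>0) * (u' - u) = 0"
        using hu[OF u(1)] hu[OF u'(1)] by (simp add: h_def algebra_simps)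
      then have "\<kappa> = \<kappa>0" using u'(2) by simp
      then have "1 / b (l t) + \<kappa> * (x - t) = h x" for x
        using hu[OF u(1)] by (simp add: h_def algebra_simps)
      then have "ball t r \<subseteq> C" using r(2) CI by auto
      then show ?thesis using r(1) by (auto simp: mem_interior)
    qed
    then show ?thesis by (metis closure_subset closure_eq subsetI subset_antisym)
  qed
  ultimately have "interior C = UNIV" using clopen[of "interior C"] by auto
  then have "x \<in> C" using interior_subset by blast
  from CD(1,2)[OF this] show ?thesis by (simp add: l_def)
qed

text \<open>The slope \<open>- a / b\<close> is that of the kernel of the Jacobian, so the complete level line
  consists of points at which its direction is a null vector.\<close>

lemma null_line_nonvertical:
  assumes "b z \<noteq> 0"
  shows "\<exists>v. v \<noteq> 0 \<and> (\<forall>t. (b (z + t *\<^sub>R v) \<noteq> 0 \<or> c (z + t *\<^sub>R v) \<noteq> 0) \<and>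
           a (z + t *\<^sub>R v) * fst v + b (z + t *\<^sub>R v) * snd v = 0 \<and>
           c (z + t *\<^sub>R v) * fst v - a (z + t *\<^sub>R v) * snd v = 0)"
proof -
  define m where "m = - a z / b z"
  have "b (z + t *\<^sub>R (1, m)) \<noteq> 0 \<and> a (z + t *\<^sub>R (1, m)) + b (z + t *\<^sub>R (1, m)) * m = 0 \<and>
      c (z + t *\<^sub>R (1, m)) - a (z + t *\<^sub>R (1, m)) * m = 0" for t
  proof -
    define w where "w = z + t *\<^sub>R (1, m)"
    have "w = (fst z + t, snd z + m * (fst z + t - fst z))"
      by (simp add: w_def prod_eq_iff mult.commute)
    then have bw: "b w \<noteq> 0" "- a w / b w = m"
      using level_line_complete[of "fst z" "snd z" m "fst z + t"] assms by (simp_all add: m_def)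
    then have aw: "a w = - (b w * m)" by (simp add: field_simps)
    have "b w * (c w - a w * m) = (a w)\<^sup>2 + b w * c w"
      by (simp add: aw power2_eq_square algebra_simps)
    then have "c w - a w * m = 0" using bw(1) unfolding det by (simp only: mult_eq_0_iff) blast
    moreover have "a w + b w * m = 0" using aw by simp
    ultimately show ?thesis using bw(1) unfolding w_def by blast
  qed
  moreover have "(1, m) \<noteq> (0 :: real \<times> real)" by (simp add: prod_eq_iff)
  ultimately show ?thesis
    by (intro exI[of _ "(1, m)"]) (simp only: fst_conv snd_conv mult_1_right simp_thms)
qed

text \<open>Exchanging the two coordinates exchanges the roles of \<open>b\<close> and \<open>c\<close>. Wherever the Jacobian is not
  zero one of the two is nonzero, so this reduces everything to the case \<open>b \<noteq> 0\<close>.\<close>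

lemma swapped: "nilpotent_plane_field (Q \<circ> prod.swap) (P \<circ> prod.swap)
    (\<lambda>z. - a (prod.swap z)) (c \<circ> prod.swap) (b \<circ> prod.swap)"
proof
  have sw: "(prod.swap has_derivative prod.swap) (at z)" for z :: "real \<times> real"
    unfolding prod.swap_def by (intro derivative_eq_intros) auto
  show "(Q \<circ> prod.swap has_derivative
      (\<lambda>h. - a (prod.swap z) * fst h + (c \<circ> prod.swap) z * snd h)) (at z)" for z
    using has_derivative_compose[OF sw derQ] by (simp add: o_def algebra_simps)
  show "(P \<circ> prod.swap has_derivative
      (\<lambda>h. (b \<circ> prod.swap) z * fst h - - a (prod.swap z) * snd h)) (at z)" for z
    using has_derivative_compose[OF sw derP] by (simp add: o_def algebra_simps)
  have csw: "continuous_on UNIV (prod.swap :: real \<times> real \<Rightarrow> _)"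
    by (intro continuous_on_swap)
  show "continuous_on UNIV (\<lambda>z. - a (prod.swap z))" "continuous_on UNIV (c \<circ> prod.swap)"
    "continuous_on UNIV (b \<circ> prod.swap)"
    using continuous_on_compose2[OF cont(1) csw] continuous_on_compose2[OF cont(2) csw]
      continuous_on_compose2[OF cont(3) csw]
    by (simp_all add: o_def continuous_on_minus)
  show "(- a (prod.swap z))\<^sup>2 + (c \<circ> prod.swap) z * (b \<circ> prod.swap) z = 0" for z
    using det[of "prod.swap z"] by (simp add: mult.commute)
qed

lemma null_line:
  assumes "b z \<noteq> 0 \<or> c z \<noteq> 0"
  obtains v where "v \<noteq> 0"
    and "\<And>t. b (z + t *\<^sub>R v) \<noteq> 0 \<or> c (z + t *\<^sub>R v) \<noteq> 0"
    and "\<And>t. a (z + t *\<^sub>R v) * fst v + b (z + t *\<^sub>R v) * snd v = 0"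
    and "\<And>t. c (z + t *\<^sub>R v) * fst v - a (z + t *\<^sub>R v) * snd v = 0"
proof (cases "b z = 0")
  case False
  then show thesis using null_line_nonvertical that by blast
next
  case True
  interpret sw: nilpotent_plane_field "Q \<circ> prod.swap" "P \<circ> prod.swap"
    "\<lambda>z. - a (prod.swap z)" "c \<circ> prod.swap" "b \<circ> prod.swap"
    by (rule swapped)
  have sw_line: "prod.swap (prod.swap z + t *\<^sub>R v) = z + t *\<^sub>R prod.swap v" for t v
    by (simp add: prod_eq_iff)
  obtain v where "v \<noteq> 0" and v: "\<And>t. (c (z + t *\<^sub>R prod.swap v) \<noteq> 0 \<or> b (z + t *\<^sub>R prod.swap v) \<noteq> 0)
      \<and> - a (z + t *\<^sub>R prod.swap v) * fst v + c (z + t *\<^sub>R prod.swap v) * snd v = 0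
      \<and> b (z + t *\<^sub>R prod.swap v) * fst v - - a (z + t *\<^sub>R prod.swap v) * snd v = 0"
    using sw.null_line_nonvertical[of "prod.swap z"] assms True
    unfolding o_apply sw_line swap_swap by blast
  show thesis
  proof (rule that[of "prod.swap v"])
    show "prod.swap v \<noteq> 0" using \<open>v \<noteq> 0\<close> by (auto simp: prod_eq_iff)
    show "b (z + t *\<^sub>R prod.swap v) \<noteq> 0 \<or> c (z + t *\<^sub>R prod.swap v) \<noteq> 0"
      "a (z + t *\<^sub>R prod.swap v) * fst (prod.swap v) + b (z + t *\<^sub>R prod.swap v) * snd (prod.swap v) = 0"
      "c (z + t *\<^sub>R prod.swap v) * fst (prod.swap v) - a (z + t *\<^sub>R prod.swap v) * snd (prod.swap v) = 0"
      for t
      using v[of t] by (simp_all del: scaleR_Pair add: disj_commute)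
  qed
qed

text \<open>Two null lines that are not parallel intersect. At the intersection the Jacobian annihilates
  two independent vectors although it is nonzero on every null line, which is absurd.\<close>

lemma common_null_direction:
  obtains \<alpha> \<beta> where "\<alpha>\<^sup>2 + \<beta>\<^sup>2 = 1"
    and "\<And>z. a z * \<alpha> + b z * \<beta> = 0" "\<And>z. c z * \<alpha> - a z * \<beta> = 0"
proof (cases "\<exists>z. b z \<noteq> 0 \<or> c z \<noteq> 0")
  case False
  then have bc: "b z = 0" "c z = 0" for z by blast+
  moreover have "a z = 0" for z using det[of z] by (simp add: bc)
  ultimately show thesis using that[of 1 0] by simp
next
  case True
  then obtain z1 where "b z1 \<noteq> 0 \<or> c z1 \<noteq> 0" by blast
  then obtain v1 where "v1 \<noteq> 0" and v1:
    "\<And>t. b (z1 + t *\<^sub>R v1) \<noteq> 0 \<or> c (z1 + t *\<^sub>R v1) \<noteq> 0"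
    "\<And>t. a (z1 + t *\<^sub>R v1) * fst v1 + b (z1 + t *\<^sub>R v1) * snd v1 = 0"
    "\<And>t. c (z1 + t *\<^sub>R v1) * fst v1 - a (z1 + t *\<^sub>R v1) * snd v1 = 0"
    using null_line[of z1] by blast
  have null: "a z * fst v1 + b z * snd v1 = 0 \<and> c z * fst v1 - a z * snd v1 = 0" for z
  proof (cases "b z \<noteq> 0 \<or> c z \<noteq> 0")
    case False
    then show ?thesis using det[of z] by auto
  next
    case True
    then obtain v2 where "v2 \<noteq> 0" and v2:
      "\<And>t. b (z + t *\<^sub>R v2) \<noteq> 0 \<or> c (z + t *\<^sub>R v2) \<noteq> 0"
      "\<And>t. a (z + t *\<^sub>R v2) * fst v2 + b (z + t *\<^sub>R v2) * snd v2 = 0"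
      "\<And>t. c (z + t *\<^sub>R v2) * fst v2 - a (z + t *\<^sub>R v2) * snd v2 = 0"
      using null_line[of z] by blast
    define D where "D = fst v1 * snd v2 - snd v1 * fst v2"
    have "D = 0"
    proof (rule ccontr)
      assume D: "D \<noteq> 0"
      define d where "d = z - z1"
      \<comment> \<open>Cramer's rule for the intersection point of the two lines.\<close>
      define t where "t = (fst d * snd v2 - snd d * fst v2) / D"
      define s where "s = (fst d * snd v1 - snd d * fst v1) / D"
      have "t * fst v1 - s * fst v2 = fst d * D / D" "t * snd v1 - s * snd v2 = snd d * D / D"
        unfolding t_def s_def D_def by (simp_all add: diff_divide_distrib[symmetric] algebra_simps)
      then have "t * fst v1 - s * fst v2 = fst z - fst z1" "t * snd v1 - s * snd v2 = snd z - snd z1"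
        using D by (simp_all add: d_def)
      then have meet: "z1 + t *\<^sub>R v1 = z + s *\<^sub>R v2"
        by (simp add: prod_eq_iff algebra_simps)
      define w where "w = z + s *\<^sub>R v2"
      have w: "b w \<noteq> 0 \<or> c w \<noteq> 0"
        "a w * fst v1 + b w * snd v1 = 0" "c w * fst v1 - a w * snd v1 = 0"
        "a w * fst v2 + b w * snd v2 = 0" "c w * fst v2 - a w * snd v2 = 0"
        using v1(2,3)[of t] v2[of s] by (simp_all only: meet w_def)
      have "D * b w = fst v1 * (a w * fst v2 + b w * snd v2) - fst v2 * (a w * fst v1 + b w * snd v1)"
        "D * c w = snd v2 * (c w * fst v1 - a w * snd v1) - snd v1 * (c w * fst v2 - a w * snd v2)"
        by (simp_all add: D_def algebra_simps)
      then have "b w = 0" "c w = 0" using w D by simp_all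
      then show False using w(1) by simp
    qed
    have e: "a z * fst v2 + b z * snd v2 = 0" "c z * fst v2 - a z * snd v2 = 0"
      using v2(2,3)[of 0] by simp_all
    have "fst v2 * (a z * fst v1 + b z * snd v1) = fst v1 * (a z * fst v2 + b z * snd v2) - b z * D"
      "snd v2 * (a z * fst v1 + b z * snd v1) = snd v1 * (a z * fst v2 + b z * snd v2) + a z * D"
      "fst v2 * (c z * fst v1 - a z * snd v1) = fst v1 * (c z * fst v2 - a z * snd v2) + a z * D"
      "snd v2 * (c z * fst v1 - a z * snd v1) = snd v1 * (c z * fst v2 - a z * snd v2) + c z * D"
      by (simp_all add: D_def algebra_simps)
    then show ?thesis using e \<open>D = 0\<close> \<open>v2 \<noteq> 0\<close> by (auto simp: prod_eq_iff)
  qed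
  define n where "n = sqrt ((fst v1)\<^sup>2 + (snd v1)\<^sup>2)"
  have n: "n > 0" "n\<^sup>2 = (fst v1)\<^sup>2 + (snd v1)\<^sup>2"
    using \<open>v1 \<noteq> 0\<close> by (auto simp: n_def prod_eq_iff sum_power2_gt_zero_iff)
  show thesis
  proof (rule that[of "fst v1 / n" "snd v1 / n"])
    show "(fst v1 / n)\<^sup>2 + (snd v1 / n)\<^sup>2 = 1"
      using n by (simp add: power_divide add_divide_distrib[symmetric] flip: n(2))
    have "a z * (fst v1 / n) + b z * (snd v1 / n) = (a z * fst v1 + b z * snd v1) / n"
      "c z * (fst v1 / n) - a z * (snd v1 / n) = (c z * fst v1 - a z * snd v1) / n" for z
      by (simp_all add: add_divide_distrib diff_divide_distrib)
    with null show "a z * (fst v1 / n) + b z * (snd v1 / n) = 0"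
      "c z * (fst v1 / n) - a z * (snd v1 / n) = 0" for z
      by simp_all
  qed
qed

text \<open>The image of a nonzero nilpotent \<open>2 \<times> 2\<close> matrix is its kernel. With a common null direction
  \<open>(\<alpha>, \<beta>)\<close>, the component of the field orthogonal to it is therefore constant, and the component
  along it is constant on all lines in that direction.\<close>

lemma cylindrical_form:
  obtains \<alpha> \<beta> k \<psi> where "\<alpha>\<^sup>2 + \<beta>\<^sup>2 = 1" "continuous_on UNIV \<psi>"
    and "\<And>x y. P (x, y) = \<alpha> * \<psi> (\<alpha> * y - \<beta> * x) - \<beta> * k"
    and "\<And>x y. Q (x, y) = \<beta> * \<psi> (\<alpha> * y - \<beta> * x) + \<alpha> * k"
proof -
  obtain \<alpha> \<beta> where unit: "\<alpha>\<^sup>2 + \<beta>\<^sup>2 = 1"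
    and null: "\<And>z. a z * \<alpha> + b z * \<beta> = 0" "\<And>z. c z * \<alpha> - a z * \<beta> = 0"
    using common_null_direction by blast
  have "((\<lambda>z. \<alpha> * Q z - \<beta> * P z) has_derivative
      (\<lambda>h. \<alpha> * (c z * fst h - a z * snd h) - \<beta> * (a z * fst h + b z * snd h))) (at z)" for z
    by (intro has_derivative_diff has_derivative_mult_right derP derQ)
  moreover have "\<alpha> * (c z * fst h - a z * snd h) - \<beta> * (a z * fst h + b z * snd h)
     = (c z * \<alpha> - a z * \<beta>) * fst h - (a z * \<alpha> + b z * \<beta>) * snd h" for z and h :: "real \<times> real"
    by (simp add: algebra_simps)
  ultimately have der0: "((\<lambda>z. \<alpha> * Q z - \<beta> * P z) has_derivative (\<lambda>h. 0)) (at z)" for z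
    by (simp add: null)
  have "\<exists>k. \<forall>z\<in>UNIV. \<alpha> * Q z - \<beta> * P z = k"
    by (rule has_derivative_zero_constant[OF convex_UNIV der0])
  then obtain k where k: "\<And>z. \<alpha> * Q z - \<beta> * P z = k" by auto
  define \<psi> where "\<psi> t = \<alpha> * P (- \<beta> * t, \<alpha> * t) + \<beta> * Q (- \<beta> * t, \<alpha> * t)" for t
  have contPQ: "continuous_on UNIV P" "continuous_on UNIV Q"
    by (intro continuous_at_imp_continuous_on ballI has_derivative_continuous[OF derP]
          has_derivative_continuous[OF derQ])+
  have cont\<psi>: "continuous_on UNIV \<psi>" unfolding \<psi>_def
    by (intro continuous_intros continuous_on_compose2[OF contPQ(1)] continuous_on_compose2[OF contPQ(2)])
       auto
  have tangential: "\<alpha> * P (x, y) + \<beta> * Q (x, y) = \<psi> (\<alpha> * y - \<beta> * x)" for x y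
  proof -
    \<comment> \<open>The line in the null direction through \<open>(x, y)\<close>, which starts at the foot point on the
      orthogonal axis.\<close>
    define l where "l s = (s * \<alpha> - \<beta> * (\<alpha> * y - \<beta> * x), s * \<beta> + \<alpha> * (\<alpha> * y - \<beta> * x))" for s
    have dl: "(l has_derivative (\<lambda>h. (h * \<alpha>, h * \<beta>))) (at s)" for s
      unfolding l_def by (auto intro!: derivative_eq_intros)
    have Pl: "((\<lambda>s. P (l s)) has_real_derivative 0) (at s)" for s
    proof (rule has_derivative_imp_has_field_derivative[OF has_derivative_compose[OF dl derP]])
      have "a (l s) * (h * \<alpha>) + b (l s) * (h * \<beta>) = h * (a (l s) * \<alpha> + b (l s) * \<beta>)" for h
        by (simp add: algebra_simps)
      then show "h * 0 = a (l s) * fst (h * \<alpha>, h * \<beta>) + b (l s) * snd (h * \<alpha>, h * \<beta>)" for h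
        by (simp add: null)
    qed
    have Ql: "((\<lambda>s. Q (l s)) has_real_derivative 0) (at s)" for s
    proof (rule has_derivative_imp_has_field_derivative[OF has_derivative_compose[OF dl derQ]])
      have "c (l s) * (h * \<alpha>) - a (l s) * (h * \<beta>) = h * (c (l s) * \<alpha> - a (l s) * \<beta>)" for h
        by (simp add: algebra_simps)
      then show "h * 0 = c (l s) * fst (h * \<alpha>, h * \<beta>) - a (l s) * snd (h * \<alpha>, h * \<beta>)" for h
        by (simp add: null)
    qed
    have PQ: "P (l (\<alpha> * x + \<beta> * y)) = P (l 0)" "Q (l (\<alpha> * x + \<beta> * y)) = Q (l 0)"
      using DERIV_isconst_all[of "\<lambda>s. P (l s)"] DERIV_isconst_all[of "\<lambda>s. Q (l s)"] Pl Ql by auto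
    have "(\<alpha> * x + \<beta> * y) * \<alpha> - \<beta> * (\<alpha> * y - \<beta> * x) = (\<alpha>\<^sup>2 + \<beta>\<^sup>2) * x"
      "(\<alpha> * x + \<beta> * y) * \<beta> + \<alpha> * (\<alpha> * y - \<beta> * x) = (\<alpha>\<^sup>2 + \<beta>\<^sup>2) * y"
      by (simp_all add: algebra_simps power2_eq_square)
    then have "l (\<alpha> * x + \<beta> * y) = (x, y)" by (simp add: l_def unit)
    with PQ show ?thesis by (simp add: \<psi>_def l_def)
  qed
  have PQ: "P (x, y) = \<alpha> * \<psi> (\<alpha> * y - \<beta> * x) - \<beta> * k"
    "Q (x, y) = \<beta> * \<psi> (\<alpha> * y - \<beta> * x) + \<alpha> * k" for x y
  proof -
    have "(\<alpha>\<^sup>2 + \<beta>\<^sup>2) * P (x, y) =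
        \<alpha> * (\<alpha> * P (x, y) + \<beta> * Q (x, y)) - \<beta> * (\<alpha> * Q (x, y) - \<beta> * P (x, y))"
      by (simp add: algebra_simps power2_eq_square)
    then show "P (x, y) = \<alpha> * \<psi> (\<alpha> * y - \<beta> * x) - \<beta> * k"
      by (simp only: tangential unit k mult_1_left)
    have "(\<alpha>\<^sup>2 + \<beta>\<^sup>2) * Q (x, y) =
        \<beta> * (\<alpha> * P (x, y) + \<beta> * Q (x, y)) + \<alpha> * (\<alpha> * Q (x, y) - \<beta> * P (x, y))"
      by (simp add: algebra_simps power2_eq_square)
    then show "Q (x, y) = \<beta> * \<psi> (\<alpha> * y - \<beta> * x) + \<alpha> * k"
      by (simp only: tangential unit k mult_1_left)
  qed
  show thesis by (rule that[OF unit cont\<psi> PQ])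
qed

end

section \<open>Conjugacies to the translation\<close>

text \<open>The solution is the sum of \<open>f\<close> over all points \<open>t - 1, t - 2, \<dots>\<close>. Since \<open>f\<close> vanishes on the
  negative half line, the sum may be cut off at any index beyond \<open>t\<close>; it is locally finite and
  hence continuous.\<close>

lemma zero_extended_cocycle_eq_coboundary:
  fixes f :: "real \<Rightarrow> real"
  assumes cont: "continuous_on UNIV f" and zero: "\<And>t. t \<le> 0 \<Longrightarrow> f t = 0"
  obtains \<theta> where "continuous_on UNIV \<theta>" "\<And>t. \<theta> (t + 1) = \<theta> t + f t"
proof -
  define \<theta> where "\<theta> t = (\<Sum>j<nat \<lceil>t\<rceil>. f (t - 1 - real j))" for t
  have \<theta>_eq: "\<theta> t = (\<Sum>j<N. f (t - 1 - real j))" if "t \<le> real N" for t N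
    unfolding \<theta>_def
  proof (rule sum.mono_neutral_left)
    show "{..<nat \<lceil>t\<rceil>} \<subseteq> {..<N}" using that by (auto simp: ceiling_le_iff nat_le_iff)
    show "\<forall>j\<in>{..<N} - {..<nat \<lceil>t\<rceil>}. f (t - 1 - real j) = 0"
    proof
      fix j assume "j \<in> {..<N} - {..<nat \<lceil>t\<rceil>}"
      then have "t \<le> real j" by (auto simp: not_less nat_le_iff ceiling_le_iff)
      then show "f (t - 1 - real j) = 0" by (intro zero) simp
    qed
  qed simp
  have fsum: "continuous_on UNIV (\<lambda>t. \<Sum>j<N. f (t - 1 - real j))" for N :: nat
    by (intro continuous_intros continuous_on_compose2[OF cont]) auto
  have "isCont \<theta> t" for t
  proof -
    obtain N :: nat where N: "t < real N" using reals_Archimedean2 by blast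
    have "continuous_on {..<real N} \<theta>"
      using continuous_on_subset[OF fsum[of N], of "{..<real N}"]
      by (subst continuous_on_cong[OF refl \<theta>_eq]) auto
    then show ?thesis using N by (simp add: continuous_on_eq_continuous_at)
  qed
  then have "continuous_on UNIV \<theta>" by (simp add: continuous_at_imp_continuous_on)
  moreover have "\<theta> (t + 1) = \<theta> t + f t" for t
  proof -
    obtain N :: nat where N: "t < real N" using reals_Archimedean2 by blast
    have "\<theta> (t + 1) = (\<Sum>j<Suc N. f (t - real j))"
      using \<theta>_eq[of "t + 1" "Suc N"] N by simp
    also have "\<dots> = f t + (\<Sum>j<N. f (t - 1 - real j))"
      by (simp add: sum.lessThan_Suc_shift algebra_simps del: sum.lessThan_Suc)
    finally show ?thesis using \<theta>_eq[of t N] N by simp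
  qed
  ultimately show thesis using that by blast
qed

text \<open>A constant is the coboundary of a linear function. After subtracting \<open>\<sigma> 0\<close> the function splits
  at \<open>0\<close> into two continuous pieces, each vanishing on a half line; one is summed to the left
  and the other, by reflection, to the right.\<close>

lemma continuous_function_is_coboundary_of_unit_shift:
  fixes \<sigma> :: "real \<Rightarrow> real"
  assumes cont: "continuous_on UNIV \<sigma>"
  obtains \<theta> where "continuous_on UNIV \<theta>" "\<And>t. \<theta> (t + 1) = \<theta> t + \<sigma> t"
proof -
  define \<tau> where "\<tau> t = \<sigma> t - \<sigma> 0" for t
  have c: "continuous_on UNIV \<tau>" unfolding \<tau>_def by (intro continuous_intros cont)
  have "continuous_on UNIV (\<lambda>t. \<tau> (max t 0))" "continuous_on UNIV (\<lambda>t. \<tau> (min (- t) 0))"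
    by (intro continuous_on_compose2[OF c] continuous_intros; simp)+
  moreover have "t \<le> 0 \<Longrightarrow> \<tau> (max t 0) = 0" "t \<le> 0 \<Longrightarrow> \<tau> (min (- t) 0) = 0" for t
    by (simp_all add: \<tau>_def)
  ultimately have cocycles: "continuous_on UNIV (\<lambda>t. \<tau> (max t 0))"
      "continuous_on UNIV (\<lambda>t. \<tau> (min (- t) 0))"
      "t \<le> 0 \<Longrightarrow> \<tau> (max t 0) = 0" "t \<le> 0 \<Longrightarrow> \<tau> (min (- t) 0) = 0" for t
    by simp_all
  obtain \<theta>1 where 1: "continuous_on UNIV \<theta>1" "\<And>t. \<theta>1 (t + 1) = \<theta>1 t + \<tau> (max t 0)"
    using zero_extended_cocycle_eq_coboundary[OF cocycles(1,3)] by metis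
  obtain \<theta>2 where 2: "continuous_on UNIV \<theta>2" "\<And>t. \<theta>2 (t + 1) = \<theta>2 t + \<tau> (min (- t) 0)"
    using zero_extended_cocycle_eq_coboundary[OF cocycles(2,4)] by metis
  define \<theta> where "\<theta> t = \<theta>1 t - \<theta>2 (1 - t) + \<sigma> 0 * t" for t
  have "continuous_on UNIV \<theta>" unfolding \<theta>_def
    by (intro continuous_intros 1(1) continuous_on_compose2[OF 2(1)]) auto
  moreover have "\<theta> (t + 1) = \<theta> t + \<sigma> t" for t
    using 1(2)[of t] 2(2)[of "- t"]
    by (cases "t \<le> 0") (auto simp: \<theta>_def \<tau>_def algebra_simps max_def min_def)
  ultimately show thesis using that by blast
qed

lemma topologically_conjugated_trans:
  assumes "topologically_conjugated F G" "topologically_conjugated G H"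
  shows "topologically_conjugated F H"
proof -
  obtain f f' where f: "homeomorphism UNIV UNIV f f'" "f \<circ> F \<circ> f' = G"
    using assms(1) unfolding topologically_conjugated_def by blast
  obtain g g' where g: "homeomorphism UNIV UNIV g g'" "g \<circ> G \<circ> g' = H"
    using assms(2) unfolding topologically_conjugated_def by blast
  show ?thesis unfolding topologically_conjugated_def
    using homeomorphism_compose[OF f(1) g(1)]
    by (intro exI[of _ "g \<circ> f"] exI[of _ "f' \<circ> g'"]) (simp add: o_assoc flip: f(2) g(2))
qed

lemma topologically_conjugatedI:
  assumes "continuous_on UNIV \<phi>" "continuous_on UNIV \<phi>'"
    and "\<And>x. \<phi>' (\<phi> x) = x" "\<And>y. \<phi> (\<phi>' y) = y" "\<And>x. \<phi> (F x) = G (\<phi> x)"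
  shows "topologically_conjugated F G"
  unfolding topologically_conjugated_def
  by (intro exI[of _ \<phi>] exI[of _ \<phi>'] conjI homeomorphismI) (use assms in \<open>auto simp: fun_eq_iff\<close>)

text \<open>For \<open>k = 0\<close> each horizontal line is translated by \<open>\<psi> t\<close>, which can be rescaled to \<open>1\<close>. For
  \<open>k \<noteq> 0\<close> the coordinate \<open>t / k\<close> already moves by \<open>1\<close>, and a solution of the cohomological equation
  removes the motion in the other coordinate.\<close>

lemma skew_translation_conjugated_to_translation:
  fixes \<psi> :: "real \<Rightarrow> real" and k :: real
  assumes cont: "continuous_on UNIV \<psi>" and free: "k = 0 \<Longrightarrow> (\<And>t. \<psi> t \<noteq> 0)"
  shows "topologically_conjugated (\<lambda>(s, t). (s + \<psi> t, t + k)) (\<lambda>(x, y). (x + 1 :: real, y :: real))"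
proof (cases "k = 0")
  case True
  have nz: "\<And>t. \<psi> t \<noteq> 0" using free True by blast
  have c: "continuous_on UNIV (\<lambda>z :: real \<times> real. \<psi> (snd z))"
    by (intro continuous_on_compose2[OF cont] continuous_intros) auto
  show ?thesis
  proof (rule topologically_conjugatedI)
    show "continuous_on UNIV (\<lambda>z. (fst z / \<psi> (snd z), snd z))"
      using nz by (intro continuous_intros c) auto
    show "continuous_on UNIV (\<lambda>z. (fst z * \<psi> (snd z), snd z))"
      by (intro continuous_intros c)
  qed (use True nz in \<open>auto simp: add_divide_distrib\<close>)
next
  case False
  have "continuous_on UNIV (\<lambda>t. \<psi> (k * t))"
    by (intro continuous_on_compose2[OF cont] continuous_intros) auto
  then obtain \<theta> where \<theta>: "continuous_on UNIV \<theta>" "\<And>t. \<theta> (t + 1) = \<theta> t + \<psi> (k * t)"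
    using continuous_function_is_coboundary_of_unit_shift by blast
  have step: "\<theta> (t / k + 1) = \<theta> (t / k) + \<psi> t" for t
    using \<theta>(2)[of "t / k"] False by simp
  have c: "continuous_on UNIV (\<lambda>z :: real \<times> real. \<theta> (snd z / k))"
          "continuous_on UNIV (\<lambda>z :: real \<times> real. \<theta> (fst z))"
    using False by (intro continuous_on_compose2[OF \<theta>(1)] continuous_intros; auto)+
  show ?thesis
  proof (rule topologically_conjugatedI)
    show "continuous_on UNIV (\<lambda>z. (snd z / k, fst z - \<theta> (snd z / k)))"
      using False by (intro continuous_intros c) auto
    show "continuous_on UNIV (\<lambda>z. (snd z + \<theta> (fst z), k * fst z))"
      by (intro continuous_intros c)
    fix z :: "real \<times> real"
    show "(snd (snd z / k, fst z - \<theta> (snd z / k)) + \<theta> (fst (snd z / k, fst z - \<theta> (snd z / k))),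
        k * fst (snd z / k, fst z - \<theta> (snd z / k))) = z"
      using False by simp
    show "(snd (snd z + \<theta> (fst z), k * fst z) / k, fst (snd z + \<theta> (fst z), k * fst z) -
        \<theta> (snd (snd z + \<theta> (fst z), k * fst z) / k)) = z"
      using False by simp
    obtain s t where z: "z = (s, t)" by (cases z)
    show "(snd (case z of (s, t) \<Rightarrow> (s + \<psi> t, t + k)) / k,
        fst (case z of (s, t) \<Rightarrow> (s + \<psi> t, t + k)) - \<theta> (snd (case z of (s, t) \<Rightarrow> (s + \<psi> t, t + k)) / k)) =
        (case (snd z / k, fst z - \<theta> (snd z / k)) of (x, y) \<Rightarrow> (x + 1, y))"
      using step[of t] False by (simp add: z add_divide_distrib)
  qed
qed

text \<open>The conjugacy is the rotation to the orthonormal coordinates along and across the common null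
  direction, followed by that of the skew translation.\<close>

lemma (in nilpotent_plane_field) conjugated_to_translation:
  assumes nz: "\<And>z. (P z, Q z) \<noteq> 0"
  shows "topologically_conjugated (\<lambda>z. z + (P z, Q z)) (\<lambda>(x, y). (x + 1 :: real, y :: real))"
proof (rule cylindrical_form)
  fix \<alpha> \<beta> k \<psi>
  assume unit: "\<alpha>\<^sup>2 + \<beta>\<^sup>2 = 1" and cont\<psi>: "continuous_on UNIV \<psi>"
    and P: "\<And>x y. P (x, y) = \<alpha> * \<psi> (\<alpha> * y - \<beta> * x) - \<beta> * k"
    and Q: "\<And>x y. Q (x, y) = \<beta> * \<psi> (\<alpha> * y - \<beta> * x) + \<alpha> * k"
  have unit': "\<alpha> * (\<alpha> * r) + \<beta> * (\<beta> * r) = r" "\<beta> * (\<beta> * r) + \<alpha> * (\<alpha> * r) = r" for r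
  proof -
    have "(\<alpha>\<^sup>2 + \<beta>\<^sup>2) * r = \<alpha> * (\<alpha> * r) + \<beta> * (\<beta> * r)"
      by (simp add: algebra_simps power2_eq_square)
    then show "\<alpha> * (\<alpha> * r) + \<beta> * (\<beta> * r) = r" "\<beta> * (\<beta> * r) + \<alpha> * (\<alpha> * r) = r"
      by (simp_all add: unit)
  qed
  define \<rho> where "\<rho> z = (\<alpha> * fst z + \<beta> * snd z, \<alpha> * snd z - \<beta> * fst z)" for z
  define \<rho>' where "\<rho>' z = (\<alpha> * fst z - \<beta> * snd z, \<beta> * fst z + \<alpha> * snd z)" for z
  have "topologically_conjugated (\<lambda>z. z + (P z, Q z)) (\<lambda>(s, t). (s + \<psi> t, t + k))"
  proof (rule topologically_conjugatedI)
    show "continuous_on UNIV \<rho>" "continuous_on UNIV \<rho>'"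
      unfolding \<rho>_def \<rho>'_def by (intro continuous_intros)+
    show "\<rho>' (\<rho> z) = z" "\<rho> (\<rho>' z) = z" for z
      using unit'[of "fst z"] unit'[of "snd z"]
      by (simp_all add: \<rho>_def \<rho>'_def prod_eq_iff algebra_simps)
    show "\<rho> (z + (P z, Q z)) = (case \<rho> z of (s, t) \<Rightarrow> (s + \<psi> t, t + k))" for z
    proof (cases z)
      case (Pair x y)
      show ?thesis
        using unit'[of "\<psi> (\<alpha> * y - \<beta> * x)"] unit'[of k]
        by (simp add: \<rho>_def Pair P Q algebra_simps)
    qed
  qed
  moreover have "topologically_conjugated (\<lambda>(s, t). (s + \<psi> t, t + k)) (\<lambda>(x, y). (x + 1 :: real, y :: real))"
  proof (rule skew_translation_conjugated_to_translation[OF cont\<psi>])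
    fix t assume "k = 0"
    have "\<alpha> * (\<alpha> * t) - \<beta> * (- \<beta> * t) = t" using unit'[of t] by simp
    then have "(P (- \<beta> * t, \<alpha> * t), Q (- \<beta> * t, \<alpha> * t)) = (\<alpha> * \<psi> t, \<beta> * \<psi> t)"
      unfolding P Q \<open>k = 0\<close> by simp
    with nz[of "(- \<beta> * t, \<alpha> * t)"] show "\<psi> t \<noteq> 0" by (auto simp flip: zero_prod_def)
  qed
  ultimately show ?thesis by (rule topologically_conjugated_trans)
qed

section \<open>Unipotent matrices and maps\<close>

text \<open>A vector orthogonal to a nonzero row of the singular matrix \<open>A - c\<close> is an eigenvector; the
  exceptional case is a vanishing second column, where the second unit vector serves.\<close>

lemma complex_eigenvalue_if_characteristic_root:
  fixes A :: "real ^ 2 ^ 2" and c :: complex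
  assumes "(of_real (A $ 1 $ 1) - c) * (of_real (A $ 2 $ 2) - c) = of_real (A $ 1 $ 2 * A $ 2 $ 1)"
  shows "c \<in> complex_eigenvalues A"
proof -
  define p q r s where "p = complex_of_real (A $ 1 $ 1)" and "q = complex_of_real (A $ 1 $ 2)"
    and "r = complex_of_real (A $ 2 $ 1)" and "s = complex_of_real (A $ 2 $ 2)"
  have root: "(p - c) * (s - c) = q * r" using assms by (simp add: p_def q_def r_def s_def)
  have "\<exists>x y. (x \<noteq> 0 \<or> y \<noteq> 0) \<and> p * x + q * y = c * x \<and> r * x + s * y = c * y"
  proof (cases "q = 0")
    case False
    then show ?thesis
      using root by (intro exI[of _ q] exI[of _ "c - p"]) (simp add: algebra_simps)
  next
    case q: True
    show ?thesis
    proof (cases "s = c")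
      case True
      then show ?thesis using q by (intro exI[of _ 0] exI[of _ 1]) simp
    next
      case False
      then have "p = c" using root q by simp
      then show ?thesis
        using q False by (intro exI[of _ "c - s"] exI[of _ r]) (simp add: algebra_simps)
    qed
  qed
  then obtain x y where xy: "x \<noteq> 0 \<or> y \<noteq> 0" "p * x + q * y = c * x" "r * x + s * y = c * y"
    by blast
  define v :: "complex ^ 2" where "v = vector [x, y]"
  have "v $ 1 = x" "v $ 2 = y" by (simp_all add: v_def)
  then have "v \<noteq> 0" "map_matrix complex_of_real A *v v = c *s v"
    using xy by (auto simp: vec_eq_iff forall_2 matrix_vector_mult_def sum_2 map_matrix_def
        p_def q_def r_def s_def)
  then show ?thesis by (auto simp: complex_eigenvalues_def)
qed

text \<open>Both roots of the characteristic polynomial, given by the quadratic formula over the complex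
  numbers, are eigenvalues and hence equal to \<open>1\<close>.\<close>

lemma trace_det_of_unipotent_matrix:
  fixes A :: "real ^ 2 ^ 2"
  assumes "complex_eigenvalues A \<subseteq> {1}"
  shows "A $ 1 $ 1 + A $ 2 $ 2 = 2"
    and "A $ 1 $ 1 * A $ 2 $ 2 - A $ 1 $ 2 * A $ 2 $ 1 = 1"
proof -
  define T D where "T = A $ 1 $ 1 + A $ 2 $ 2" and "D = A $ 1 $ 1 * A $ 2 $ 2 - A $ 1 $ 2 * A $ 2 $ 1"
  define d where "d = csqrt (of_real (T\<^sup>2 - 4 * D))"
  have d2: "d\<^sup>2 = of_real (T\<^sup>2 - 4 * D)" unfolding d_def by (rule power2_csqrt)
  have root: "c = 1" if "c = (of_real T + e) / 2" "e\<^sup>2 = of_real (T\<^sup>2 - 4 * D)" for c e :: complex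
  proof -
    have "4 * (c\<^sup>2 - of_real T * c + of_real D) = e\<^sup>2 - of_real (T\<^sup>2 - 4 * D)"
      unfolding that(1) by (simp add: field_simps power2_eq_square)
    also have "\<dots> = 0" using that(2) by simp
    finally have "c\<^sup>2 - of_real T * c + of_real D = 0" by (simp only: mult_eq_0_iff) simp
    then have "(of_real (A $ 1 $ 1) - c) * (of_real (A $ 2 $ 2) - c) = of_real (A $ 1 $ 2 * A $ 2 $ 1)"
      by (simp add: T_def D_def algebra_simps power2_eq_square)
    then show ?thesis using complex_eigenvalue_if_characteristic_root assms by blast
  qed
  have "(of_real T + d) / 2 = 1" "(of_real T + - d) / 2 = 1"
    using root[OF refl, of d] root[OF refl, of "- d"] d2 by simp_all
  then have sums: "of_real T + d = 2" "of_real T - d = 2" by simp_all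
  have "2 * of_real T = (of_real T + d) + (of_real T - d)" by simp
  also have "\<dots> = (4 :: complex)" by (simp only: sums) simp
  finally have "complex_of_real T = of_real 2" by simp
  then have T: "T = 2" using of_real_eq_iff by blast
  with sums have "d = 0" by simp
  with d2 have "complex_of_real (T\<^sup>2 - 4 * D) = 0" by simp
  then have "T\<^sup>2 - 4 * D = 0" using of_real_eq_0_iff by blast
  then have "D = 1" using T by simp
  with T show "A $ 1 $ 1 + A $ 2 $ 2 = 2" "A $ 1 $ 1 * A $ 2 $ 2 - A $ 1 $ 2 * A $ 2 $ 1 = 1"
    by (simp_all add: T_def D_def)
qed

text \<open>With trace \<open>2\<close> and determinant \<open>1\<close> for the Jacobian of \<open>G\<close>, subtracting the identity leaves a
  matrix whose trace and determinant are both \<open>0\<close>.\<close>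

lemma displacement_of_unipotent_map_is_nilpotent_plane_field:
  fixes G :: "real ^ 2 \<Rightarrow> real ^ 2"
  assumes "C1_map G" and "unipotent_map G"
  obtains a b c where "nilpotent_plane_field
    (\<lambda>z. G (vector [fst z, snd z]) $ 1 - fst z) (\<lambda>z. G (vector [fst z, snd z]) $ 2 - snd z) a b c"
proof -
  obtain G' where derG: "\<And>z. (G has_derivative blinfun_apply (G' z)) (at z)"
    and contG': "continuous_on UNIV G'"
    using assms(1) unfolding C1_map_def by blast
  define \<rho> :: "real \<times> real \<Rightarrow> real ^ 2" where "\<rho> z = vector [fst z, snd z]" for z
  have \<rho>_axis: "\<rho> z = fst z *\<^sub>R axis 1 1 + snd z *\<^sub>R axis 2 1" for z
    by (simp add: \<rho>_def vec_eq_iff forall_2 axis_def)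
  have der\<rho>: "(\<rho> has_derivative \<rho>) (at z)" for z
    unfolding \<rho>_axis by (intro derivative_eq_intros) auto
  have cont\<rho>: "continuous_on UNIV \<rho>"
    unfolding \<rho>_axis by (intro continuous_intros)
  define e where "e i j z = blinfun_apply (G' (\<rho> z)) (axis j 1) $ i" for i j z
  have cont_e: "continuous_on UNIV (e i j)" for i j
    unfolding e_def
    by (intro continuous_intros continuous_on_compose2[OF contG' cont\<rho>]) auto
  have jac: "jacobian G (at (\<rho> z)) $ i $ j = e i j z" for i j z
    using frechet_derivative_at[OF derG[of "\<rho> z"]]
    by (simp add: jacobian_def matrix_def e_def)
  have "complex_eigenvalues (jacobian G (at (\<rho> z))) \<subseteq> {1}" for z
    using assms(2) unfolding unipotent_map_def Spc_def by blast
  note td = trace_det_of_unipotent_matrix[OF this, unfolded jac]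
  have e22: "e 2 2 z = 2 - e 1 1 z" for z using td(1)[of z] by simp
  have derGi: "((\<lambda>z. G (\<rho> z) $ i) has_derivative (\<lambda>h. e i 1 z * fst h + e i 2 z * snd h)) (at z)" for i z
  proof -
    have "((\<lambda>z. G (\<rho> z) $ i) has_derivative (\<lambda>h. blinfun_apply (G' (\<rho> z)) (\<rho> h) $ i)) (at z)"
      by (rule bounded_linear.has_derivative[OF bounded_linear_vec_nth
            has_derivative_compose[OF der\<rho> derG]])
    moreover have "blinfun_apply (G' (\<rho> z)) (\<rho> h) $ i = e i 1 z * fst h + e i 2 z * snd h" for h
      by (simp add: \<rho>_axis[of h] e_def blinfun.add_right blinfun.scaleR_right mult.commute)
    ultimately show ?thesis by simp
  qed
  have "nilpotent_plane_field (\<lambda>z. G (\<rho> z) $ 1 - fst z) (\<lambda>z. G (\<rho> z) $ 2 - snd z)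
     (\<lambda>z. e 1 1 z - 1) (e 1 2) (e 2 1)"
  proof
    show "((\<lambda>z. G (\<rho> z) $ 1 - fst z) has_derivative
        (\<lambda>h. (e 1 1 z - 1) * fst h + e 1 2 z * snd h)) (at z)" for z
      by (rule has_derivative_eq_rhs[OF has_derivative_diff[OF derGi has_derivative_fst[OF has_derivative_ident]]])
         (simp add: fun_eq_iff algebra_simps)
    show "((\<lambda>z. G (\<rho> z) $ 2 - snd z) has_derivative
        (\<lambda>h. e 2 1 z * fst h - (e 1 1 z - 1) * snd h)) (at z)" for z
      by (rule has_derivative_eq_rhs[OF has_derivative_diff[OF derGi has_derivative_snd[OF has_derivative_ident]]])
         (simp add: fun_eq_iff e22 algebra_simps)
    show "continuous_on UNIV (\<lambda>z. e 1 1 z - 1)" "continuous_on UNIV (e 1 2)" "continuous_on UNIV (e 2 1)"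
      by (intro continuous_intros cont_e)+
    show "(e 1 1 z - 1)\<^sup>2 + e 1 2 z * e 2 1 z = 0" for z
      using td(2)[of z] by (simp add: e22 power2_eq_square algebra_simps)
  qed
  then show thesis unfolding \<rho>_def by (rule that)
qed

theorem theorem6p2:
  fixes G :: "real ^ 2 \<Rightarrow> real ^ 2"
  assumes "C1_map G"
    and "unipotent_map G"
    and "fixed_point_free G"
  shows "topologically_conjugated G global_translation"
proof -
  define P Q where P_def: "P = (\<lambda>z. G (vector [fst z, snd z]) $ 1 - fst z)"
    and Q_def: "Q = (\<lambda>z. G (vector [fst z, snd z]) $ 2 - snd z)"
  obtain a b c where "nilpotent_plane_field P Q a b c"
    unfolding P_def Q_def
    by (rule displacement_of_unipotent_map_is_nilpotent_plane_field[OF assms(1,2)])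
  then interpret nilpotent_plane_field P Q a b c .
  define \<rho> :: "real \<times> real \<Rightarrow> real ^ 2" where "\<rho> z = vector [fst z, snd z]" for z
  define \<rho>' :: "real ^ 2 \<Rightarrow> real \<times> real" where "\<rho>' p = (p $ 1, p $ 2)" for p
  have \<rho>_axis: "\<rho> z = fst z *\<^sub>R axis 1 1 + snd z *\<^sub>R axis 2 1" for z
    by (simp add: \<rho>_def vec_eq_iff forall_2 axis_def)
  have cont: "continuous_on UNIV \<rho>" "continuous_on UNIV \<rho>'"
    unfolding \<rho>_axis \<rho>'_def by (intro continuous_intros)+
  have inv: "\<rho> (\<rho>' p) = p" "\<rho>' (\<rho> z) = z" for p z
    by (simp_all add: \<rho>_def \<rho>'_def vec_eq_iff forall_2)
  have disp: "\<rho>' p + (P (\<rho>' p), Q (\<rho>' p)) = \<rho>' (G p)" for p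
    using inv(1)[of p] by (simp add: P_def Q_def flip: \<rho>_def) (simp add: \<rho>'_def)
  have "(P z, Q z) \<noteq> 0" for z
  proof
    assume "(P z, Q z) = 0"
    then have "\<rho>' (G (\<rho> z)) = z" using disp[of "\<rho> z"] by (simp add: inv)
    then have "G (\<rho> z) = \<rho> z" using inv(1) by metis
    then show False using assms(3) by (simp add: fixed_point_free_def)
  qed
  note field_conj = conjugated_to_translation[OF this]
  have G_conj: "topologically_conjugated G (\<lambda>z. z + (P z, Q z))"
    by (rule topologically_conjugatedI[OF cont(2,1)]) (simp_all add: inv disp)
  have translation_conj:
    "topologically_conjugated (\<lambda>(x, y). (x + 1 :: real, y :: real)) global_translation"
  proof (rule topologically_conjugatedI[OF cont inv(2,1)])
    show "\<rho> (case z of (x, y) \<Rightarrow> (x + 1, y)) = global_translation (\<rho> z)" for z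
      by (simp add: \<rho>_def global_translation_def split: prod.split)
  qed
  show ?thesis
    by (rule topologically_conjugated_trans[OF G_conj
          topologically_conjugated_trans[OF field_conj translation_conj]])
qed

end
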